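(* Let $U\supseteq V$ be two covering sets with bounds in $\mathbb{R}^n$ (upper bounds possibly infinite), and let $\alpha\ge1$. Then $U$ is an $\alpha$-approximation of $V$ if and only if $U+\mathbb{R}^n_+$ is an $\alpha$-approximation of $V+\mathbb{R}^n_+$. Moreover, this happens if and only if $U+\mathbb{R}^n_+\subseteq\frac1\alpha\,(V+\mathbb{R}^n_+)$.
   Context: A covering set with bounds is a set $\{x\in\mathbb{R}^n_+\mid A^ix\ge b_i\ \forall i\in I,\ x\le u\}$ with $I$ an arbitrary index set, each $(A^i,b_i)\in\mathbb{R}^{1\times n}_+\times\mathbb{R}_+$, and each component of $u$ either a non-negative integer or $+\infty$. For $U\supseteq V$, $U$ is an $\alpha$-approximation of $V$ if $\min\{c^\top x\mid x\in U\}\ge\frac1\alpha\min\{c^\top x\mid x\in V\}$ for all $c\in\mathbb{R}^n_+$ (minima are read as infima, with value $+\infty$ over the empty set). For a scalar $\beta>0$, $\beta S=\{\beta s\mid s\in S\}$; $+$ denotes Minkowski sum. *)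

theory Defs
  imports "HOL-Analysis.Analysis" "HOL-Library.Set_Algebras" "HOL-Library.Extended_Nat"
begin

text \<open>
  The order on \<open>real ^ 'n\<close> is the library's componentwise one, so \<open>0 \<le> x\<close> says that \<open>x\<close> lies in
  the nonnegative orthant. The bound vector has entries in \<open>enat\<close>: each is a non-negative integer
  or \<open>\<infinity>\<close>. The index set \<open>I\<close> may be infinite or empty.
\<close>

definition covering_set_with_bounds ::
  "'i set \<Rightarrow> ('i \<Rightarrow> real ^ 'n) \<Rightarrow> ('i \<Rightarrow> real) \<Rightarrow> enat ^ 'n \<Rightarrow> (real ^ 'n) set \<Rightarrow> bool"
  where
  "covering_set_with_bounds I A b u S \<longleftrightarrow>
     (\<forall>i\<in>I. 0 \<le> A i \<and> 0 \<le> b i) \<and>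
     S = {x. 0 \<le> x \<and> (\<forall>i\<in>I. A i \<bullet> x \<ge> b i) \<and> (\<forall>j. ereal (x $ j) \<le> ereal_of_enat (u $ j))}"

definition nonneg_orthant :: "(real ^ 'n) set"
  where "nonneg_orthant = {x. 0 \<le> x}"

text \<open>Values are taken in \<open>ereal\<close>, where the infimum over the empty set is \<open>\<infinity>\<close>.\<close>

definition min_value :: "real ^ 'n \<Rightarrow> (real ^ 'n) set \<Rightarrow> ereal"
  where "min_value c S = (INF x\<in>S. ereal (c \<bullet> x))"

definition is_approximation :: "real \<Rightarrow> (real ^ 'n) set \<Rightarrow> (real ^ 'n) set \<Rightarrow> bool"
  where
  "is_approximation \<alpha> U V \<longleftrightarrow>
     V \<subseteq> U \<and> (\<forall>c\<in>nonneg_orthant. min_value c U \<ge> ereal (1 / \<alpha>) * min_value c V)"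

end

theory Submission
  imports Defs
begin

text \<open>
  Nonnegative objectives do not see the added orthant, so the first equivalence is immediate.
  For the second, \<open>V + nonneg_orthant\<close> is closed, convex and closed upwards: a point of \<open>U\<close> whose
  \<open>\<alpha>\<close>-multiple lies outside it is cut off by a hyperplane whose normal is necessarily nonnegative,
  and this normal is an objective that violates the approximation property.
\<close>

lemma inner_nonneg_vec:
  fixes c x :: "real ^ 'n"
  assumes "0 \<le> c" "0 \<le> x"
  shows "0 \<le> c \<bullet> x"
  using assms by (auto simp: inner_vec_def less_eq_vec_def intro!: sum_nonneg)

text \<open>Adding the orthant is taking the upward closure: the witness for the summand is
  \<open>x - s\<close>. All later arguments use this order form of the Minkowski sum.\<close>

lemma mem_plus_nonneg_orthant:
  "x \<in> S + nonneg_orthant \<longleftrightarrow> (\<exists>s\<in>S. s \<le> x)"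
proof
  assume "x \<in> S + nonneg_orthant"
  then show "\<exists>s\<in>S. s \<le> x"
    by (auto simp: nonneg_orthant_def elim!: set_plus_elim intro: bexI[rotated])
next
  assume "\<exists>s\<in>S. s \<le> x"
  then obtain s where "s \<in> S" "s \<le> x" by auto
  then have "s + (x - s) \<in> S + nonneg_orthant"
    by (intro set_plus_intro) (auto simp: nonneg_orthant_def)
  then show "x \<in> S + nonneg_orthant" by simp
qed

lemma convex_nonneg_orthant: "convex (nonneg_orthant :: (real ^ 'n) set)"
  unfolding nonneg_orthant_def convex_def
  by (auto simp: less_eq_vec_def)

lemma min_value_plus_nonneg_orthant:
  assumes "0 \<le> c"
  shows "min_value c (S + nonneg_orthant) = min_value c S"
  unfolding min_value_def
proof (rule antisym)
  show "(INF x\<in>S + nonneg_orthant. ereal (c \<bullet> x)) \<le> (INF x\<in>S. ereal (c \<bullet> x))"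
    by (rule INF_superset_mono) (auto simp: mem_plus_nonneg_orthant)
  show "(INF x\<in>S. ereal (c \<bullet> x)) \<le> (INF x\<in>S + nonneg_orthant. ereal (c \<bullet> x))"
  proof (rule INF_greatest)
    fix x assume "x \<in> S + nonneg_orthant"
    then obtain s where "s \<in> S" "s \<le> x" by (auto simp: mem_plus_nonneg_orthant)
    moreover have "c \<bullet> s \<le> c \<bullet> x"
      using inner_nonneg_vec[OF assms, of "x - s"] \<open>s \<le> x\<close> by (simp add: inner_diff_right)
    ultimately show "(INF x\<in>S. ereal (c \<bullet> x)) \<le> ereal (c \<bullet> x)"
      by (auto intro: INF_lower2)
  qed
qed

text \<open>The values on both sides agree objective by objective. The inclusion demanded by
  \<open>is_approximation\<close> passes from the sets to the sums but not back, hence the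
  assumption.\<close>

lemma is_approximation_plus_nonneg_orthant:
  assumes "V \<subseteq> U"
  shows "is_approximation \<alpha> (U + nonneg_orthant) (V + nonneg_orthant) \<longleftrightarrow> is_approximation \<alpha> U V"
proof -
  have "V + nonneg_orthant \<subseteq> U + nonneg_orthant"
    using assms by (auto simp: set_plus_def)
  moreover have "0 \<le> c" if "c \<in> nonneg_orthant" for c :: "real ^ 'a"
    using that by (simp add: nonneg_orthant_def)
  ultimately show ?thesis
    using assms by (simp add: is_approximation_def min_value_plus_nonneg_orthant)
qed

text \<open>An infinite bound becomes a vacuous condition, so that only real inequalities
  remain.\<close>

lemma ereal_le_ereal_of_enat_iff:
  "ereal x \<le> ereal_of_enat n \<longleftrightarrow> (\<forall>m. n = enat m \<longrightarrow> x \<le> real m)"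
  by (cases n) auto

context
  fixes I :: "'i set" and A :: "'i \<Rightarrow> real ^ 'n" and b :: "'i \<Rightarrow> real" and u :: "enat ^ 'n"
    and S :: "(real ^ 'n) set"
  assumes cov: "covering_set_with_bounds I A b u S"
begin

lemma mem_covering_set:
  "x \<in> S \<longleftrightarrow>
    0 \<le> x \<and> (\<forall>i\<in>I. b i \<le> A i \<bullet> x) \<and> (\<forall>j m. u $ j = enat m \<longrightarrow> x $ j \<le> real m)"
  using cov by (auto simp: covering_set_with_bounds_def ereal_le_ereal_of_enat_iff)

lemma convex_covering_set: "convex S"
proof (rule convexI)
  fix x y :: "real ^ 'n" and s t :: real
  assume xy: "x \<in> S" "y \<in> S" and st: "0 \<le> s" "0 \<le> t" "s + t = 1"
  show "s *\<^sub>R x + t *\<^sub>R y \<in> S"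
    unfolding mem_covering_set
  proof (intro conjI ballI allI impI)
    show "0 \<le> s *\<^sub>R x + t *\<^sub>R y"
      using xy st by (auto simp: mem_covering_set less_eq_vec_def)
    show "b i \<le> A i \<bullet> (s *\<^sub>R x + t *\<^sub>R y)" if "i \<in> I" for i
      \<comment> \<open>The bound on convex combinations is stated for upper bounds, so the covering
        inequality is negated.\<close>
      using convex_bound_le[of "- (A i \<bullet> x)" "- b i" "- (A i \<bullet> y)" s t] xy st that
      by (auto simp: mem_covering_set inner_add_right)
    show "(s *\<^sub>R x + t *\<^sub>R y) $ j \<le> real m" if "u $ j = enat m" for j m
      using convex_bound_le[of "x $ j" _ "y $ j" s t] xy st that
      by (auto simp: mem_covering_set)
  qed
qed

lemma closed_covering_set: "closed S"
proof -
  have "S = {x. \<forall>j. 0 \<le> x $ j} \<inter> (\<Inter>i\<in>I. {x. b i \<le> A i \<bullet> x}) \<inter>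
      (\<Inter>j. \<Inter>m\<in>{m. u $ j = enat m}. {x. x $ j \<le> real m})"
    by (auto simp: mem_covering_set less_eq_vec_def)
  also have "closed \<dots>"
    by (intro closed_Int closed_INT ballI closed_Collect_all closed_Collect_le continuous_intros)
  finally show ?thesis .
qed

definition truncate_bounds :: "real ^ 'n \<Rightarrow> real ^ 'n" where
  "truncate_bounds x = (\<chi> j. case u $ j of enat m \<Rightarrow> min (x $ j) (real m) | \<infinity> \<Rightarrow> x $ j)"

text \<open>
  Since \<open>A \<ge> 0\<close>, the truncation of \<open>x\<close> is the best candidate for an element of \<open>S\<close> below \<open>x\<close>.
\<close>

lemma mem_covering_set_plus_nonneg_orthant:
  "x \<in> S + nonneg_orthant \<longleftrightarrow> truncate_bounds x \<in> S"
proof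
  assume "truncate_bounds x \<in> S"
  moreover have "truncate_bounds x \<le> x"
    by (auto simp: truncate_bounds_def less_eq_vec_def split: enat.split)
  ultimately show "x \<in> S + nonneg_orthant"
    by (auto simp: mem_plus_nonneg_orthant)
next
  assume "x \<in> S + nonneg_orthant"
  then obtain s where s: "s \<in> S" "s \<le> x" by (auto simp: mem_plus_nonneg_orthant)
  \<comment> \<open>\<open>s\<close> lies below \<open>x\<close> by choice and below the finite
    bounds as an element of \<open>S\<close>, hence below their minimum.\<close>
  then have le: "s \<le> truncate_bounds x"
    by (auto simp: truncate_bounds_def less_eq_vec_def mem_covering_set split: enat.split)
  show "truncate_bounds x \<in> S"
    unfolding mem_covering_set
  proof (intro conjI ballI allI impI)
    show "0 \<le> truncate_bounds x"
      using s le by (auto simp: mem_covering_set)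
    show "b i \<le> A i \<bullet> truncate_bounds x" if "i \<in> I" for i
    proof -
      have "0 \<le> A i" using cov that by (auto simp: covering_set_with_bounds_def)
      then have "A i \<bullet> s \<le> A i \<bullet> truncate_bounds x"
        using inner_nonneg_vec[of "A i" "truncate_bounds x - s"] le
        by (simp add: inner_diff_right)
      then show ?thesis using s that by (auto simp: mem_covering_set)
    qed
    show "truncate_bounds x $ j \<le> real m" if "u $ j = enat m" for j m
      using that by (simp add: truncate_bounds_def)
  qed
qed

text \<open>A sum of two closed sets can fail to be closed. Here it is the preimage of the closed
  set \<open>S\<close> under truncation, which is continuous.\<close>

lemma closed_covering_set_plus_nonneg_orthant: "closed (S + nonneg_orthant)"
proof -
  \<comment> \<open>The case distinction depends on \<open>u\<close> only, so each component is a
    projection or its minimum with a constant.\<close>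
  have "continuous_on UNIV (\<lambda>x. case u $ j of enat m \<Rightarrow> min (x $ j) (real m) | \<infinity> \<Rightarrow> x $ j)"
    for j by (cases "u $ j") (auto intro!: continuous_intros)
  then have "continuous_on UNIV truncate_bounds"
    unfolding truncate_bounds_def by (intro continuous_on_vec_lambda)
  moreover have "S + nonneg_orthant = truncate_bounds -` S"
    by (auto simp: mem_covering_set_plus_nonneg_orthant)
  ultimately show ?thesis
    using closed_covering_set by (simp add: closed_vimage)
qed

lemma convex_covering_set_plus_nonneg_orthant: "convex (S + nonneg_orthant)"
  by (intro convex_set_plus convex_covering_set convex_nonneg_orthant)

end

text \<open>The normal is nonnegative because the set is unbounded in every positive axis direction:
  along a coordinate with a negative entry the functional would fall to \<beta> or below.\<close>

lemma separation_upward_closed: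
  fixes x :: "real ^ 'n"
  assumes "closed (S + nonneg_orthant)" "convex (S + nonneg_orthant)"
    and "S \<noteq> {}" "x \<notin> S + nonneg_orthant"
  obtains c \<beta> where "0 \<le> c" "c \<bullet> x < \<beta>" "\<And>s. s \<in> S \<Longrightarrow> \<beta> < c \<bullet> s"
proof -
  obtain c \<beta> where c: "c \<bullet> x < \<beta>" "\<And>y. y \<in> S + nonneg_orthant \<Longrightarrow> \<beta> < c \<bullet> y"
    using separating_hyperplane_closed_point[OF assms(2,1,4)] by auto
  obtain s where s: "s \<in> S" using \<open>S \<noteq> {}\<close> by auto
  have "0 \<le> c $ j" for j
  proof (rule ccontr)
    assume neg: "\<not> 0 \<le> c $ j"
    \<comment> \<open>The quotient is the step length at which the functional reaches \<beta>; the
      maximum with 0 keeps the step in the orthant without a sign argument.\<close>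
    define t where "t = max 0 ((\<beta> - c \<bullet> s) / c $ j)"
    have "s + t *\<^sub>R axis j 1 \<in> S + nonneg_orthant"
      using s by (intro set_plus_intro) (auto simp: nonneg_orthant_def less_eq_vec_def axis_def t_def)
    from c(2)[OF this] have "\<beta> < c \<bullet> s + t * c $ j"
      by (simp add: inner_add_right inner_axis)
    moreover have "t * c $ j \<le> (\<beta> - c \<bullet> s) / c $ j * c $ j"
      using neg unfolding t_def by (intro mult_right_mono_neg) auto
    ultimately show False using neg by simp
  qed
  then show thesis
    using c by (intro that[of c \<beta>]) (auto simp: less_eq_vec_def mem_plus_nonneg_orthant)
qed

lemma plus_nonneg_orthant_subset_if_is_approximation:
  assumes "closed (V + nonneg_orthant)" "convex (V + nonneg_orthant)"
    and "\<alpha> > 0" and approx: "is_approximation \<alpha> U V"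
  shows "U + nonneg_orthant \<subseteq> (\<lambda>s. (1 / \<alpha>) *\<^sub>R s) ` (V + nonneg_orthant)"
proof
  fix y assume "y \<in> U + nonneg_orthant"
  then have upper: "ereal (1 / \<alpha>) * min_value c V \<le> ereal (c \<bullet> y)" if "0 \<le> c" for c
  proof -
    have "ereal (1 / \<alpha>) * min_value c V \<le> min_value c (U + nonneg_orthant)"
      using approx that
      by (simp add: is_approximation_def nonneg_orthant_def
          min_value_plus_nonneg_orthant[unfolded nonneg_orthant_def])
    also have "\<dots> \<le> ereal (c \<bullet> y)"
      unfolding min_value_def using \<open>y \<in> U + nonneg_orthant\<close> by (rule INF_lower)
    finally show ?thesis .
  qed
  \<comment> \<open>For the zero objective an empty \<open>V\<close> has value \<infinity>, also
    after scaling by the positive factor, while the value at \<open>y\<close> is 0.\<close>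
  have "V \<noteq> {}"
    using upper[of 0] \<open>\<alpha> > 0\<close> by (auto simp: min_value_def top_ereal_def)
  have "\<alpha> *\<^sub>R y \<in> V + nonneg_orthant"
  proof (rule ccontr)
    assume "\<alpha> *\<^sub>R y \<notin> V + nonneg_orthant"
    from separation_upward_closed[OF assms(1,2) \<open>V \<noteq> {}\<close> this]
    obtain c \<beta> where c: "0 \<le> c" "c \<bullet> (\<alpha> *\<^sub>R y) < \<beta>" "\<And>s. s \<in> V \<Longrightarrow> \<beta> < c \<bullet> s" by blast
    \<comment> \<open>Strictness is lost in the infimum; the contradiction comes from the strict
      inequality at the scaled point.\<close>
    have "ereal \<beta> \<le> min_value c V"
      unfolding min_value_def by (intro INF_greatest) (auto dest: c(3))
    then have "ereal (1 / \<alpha>) * ereal \<beta> \<le> ereal (1 / \<alpha>) * min_value c V"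
      using \<open>\<alpha> > 0\<close> by (intro ereal_mult_left_mono) auto
    also note upper[OF \<open>0 \<le> c\<close>]
    finally show False using c(2) \<open>\<alpha> > 0\<close> by (simp add: field_simps)
  qed
  then show "y \<in> (\<lambda>s. (1 / \<alpha>) *\<^sub>R s) ` (V + nonneg_orthant)"
    using \<open>\<alpha> > 0\<close> by (intro image_eqI[of _ _ "\<alpha> *\<^sub>R y"]) auto
qed

text \<open>Every \<open>y\<close> in \<open>U\<close> is a scaled point \<open>z\<close> of
  \<open>V + nonneg_orthant\<close>, and there the objective is at least its infimum over
  \<open>V\<close>. If \<open>V\<close> is empty, the inclusion makes \<open>U\<close> empty
  too.\<close>

lemma is_approximation_if_plus_nonneg_orthant_subset:
  assumes "\<alpha> > 0" "V \<subseteq> U"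
    and sub: "U + nonneg_orthant \<subseteq> (\<lambda>s. (1 / \<alpha>) *\<^sub>R s) ` (V + nonneg_orthant)"
  shows "is_approximation \<alpha> U V"
  unfolding is_approximation_def
proof (intro conjI ballI)
  fix c :: "real ^ 'a" assume "c \<in> nonneg_orthant"
  then have c: "0 \<le> c" by (simp add: nonneg_orthant_def)
  show "ereal (1 / \<alpha>) * min_value c V \<le> min_value c U"
    unfolding min_value_def[of c U]
  proof (rule INF_greatest)
    fix y assume "y \<in> U"
    then have "y \<in> U + nonneg_orthant" by (auto simp: mem_plus_nonneg_orthant)
    with sub obtain z where z: "z \<in> V + nonneg_orthant" "y = (1 / \<alpha>) *\<^sub>R z" by auto
    have "min_value c V \<le> ereal (c \<bullet> z)"
      using INF_lower[OF z(1), of "\<lambda>x. ereal (c \<bullet> x)"] min_value_plus_nonneg_orthant[OF c, of V]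
      by (simp add: min_value_def)
    then have "ereal (1 / \<alpha>) * min_value c V \<le> ereal (1 / \<alpha>) * ereal (c \<bullet> z)"
      using \<open>\<alpha> > 0\<close> by (intro ereal_mult_left_mono) auto
    then show "ereal (1 / \<alpha>) * min_value c V \<le> ereal (c \<bullet> y)"
      using z(2) by simp
  qed
qed (use assms in auto)

theorem proposition9:
  fixes I :: "'i set" and A :: "'i \<Rightarrow> real ^ 'n" and b :: "'i \<Rightarrow> real" and u :: "enat ^ 'n"
    and J :: "'j set" and B :: "'j \<Rightarrow> real ^ 'n" and d :: "'j \<Rightarrow> real" and w :: "enat ^ 'n"
    and U V :: "(real ^ 'n) set" and \<alpha> :: real
  assumes "covering_set_with_bounds I A b u U"
    and "covering_set_with_bounds J B d w V"
    and "V \<subseteq> U"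
    and "\<alpha> \<ge> 1"
  shows "(is_approximation \<alpha> U V \<longleftrightarrow>
            is_approximation \<alpha> (U + nonneg_orthant) (V + nonneg_orthant)) \<and>
         (is_approximation \<alpha> U V \<longleftrightarrow>
            U + nonneg_orthant \<subseteq> (\<lambda>s. (1 / \<alpha>) *\<^sub>R s) ` (V + nonneg_orthant))"
proof (intro conjI iffI)
  have "\<alpha> > 0" using \<open>\<alpha> \<ge> 1\<close> by simp
  \<comment> \<open>The separation is from \<open>V + nonneg_orthant\<close>, so the covering
    description of \<open>V\<close> enters here.\<close>
  note convex_closed = closed_covering_set_plus_nonneg_orthant[OF assms(2)]
    convex_covering_set_plus_nonneg_orthant[OF assms(2)]
  show "U + nonneg_orthant \<subseteq> (\<lambda>s. (1 / \<alpha>) *\<^sub>R s) ` (V + nonneg_orthant)"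
    if "is_approximation \<alpha> U V"
    by (rule plus_nonneg_orthant_subset_if_is_approximation[OF convex_closed \<open>\<alpha> > 0\<close> that])
  show "is_approximation \<alpha> U V"
    if "U + nonneg_orthant \<subseteq> (\<lambda>s. (1 / \<alpha>) *\<^sub>R s) ` (V + nonneg_orthant)"
    by (rule is_approximation_if_plus_nonneg_orthant_subset[OF \<open>\<alpha> > 0\<close> assms(3) that])
qed (simp_all add: is_approximation_plus_nonneg_orthant[OF assms(3)])

end
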